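(* Let $(\mathcal{X},\rho_{\rm x})$ be a finite-dimensional complete metric space and $\mathcal{U}$ a set. Let $f:\mathcal{X}\to\mathcal{X}$ be continuous and let $F:\mathcal{X}\times\mathcal{U}\to\mathcal{X}$ satisfy $f(\hat x)\in F(\hat x,\mathcal{U})$ for all $\hat x\in\mathcal{X}$. Consider the system and the tracker $$x_{k+1}=f(x_k),\qquad \hat x_{k+1}=F(\hat x_k,u_k),\qquad k\in\mathbb{N}.$$ Let $\ell:\mathcal{X}\times\mathcal{X}\to\mathbb{R}_{\geq 0}$ be symmetric, i.e., $\ell(\xi,\zeta)=\ell(\zeta,\xi)$, and let $\alpha_1,\alpha_2\in\mathcal{K}_\infty$ satisfy $$\alpha_1(\rho_{\rm x}(\xi,\zeta))\leq\ell(\xi,\zeta)\leq\alpha_2(\rho_{\rm x}(\xi,\zeta))\quad\text{for all }\xi,\zeta\in\mathcal{X}.$$ Let $N\geq 1$ be an integer. For $\hat x,x\in\mathcal{X}$ consider the problem of minimizing $$\sum_{i=0}^{N-1}\ell(z_{i+1},f(z_i))$$ over sequences $(z_i)_{i=0}^{N}$ in $\mathcal{X}$ subject to $z_0=\hat x$, $z_{i+1}\in F(z_i,\mathcal{U})$ for $i=0,\ldots,N-1$, and $z_N=f^{N}(x)$. Assume that a minimizer exists for every pair $(\hat x,x)\in\mathcal{X}\times\mathcal{X}$; denote the minimum value by $V(\hat x,x)$ and the minimizing sequence by $(\phi_i(\hat x,x))_{i=0}^{N}$, where $\phi_i:\mathcal{X}\times\mathcal{X}\to\mathcal{X}$. Suppose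 that the following two conditions hold. 1. $V:\mathcal{X}\times\mathcal{X}\to\mathbb{R}_{\geq 0}$ is continuous and there exist $\alpha_3,\alpha_4\in\mathcal{K}_\infty$ such that $\alpha_3(\rho_{\rm x}(\hat x,x))\leq V(\hat x,x)\leq\alpha_4(\rho_{\rm x}(\hat x,x))$ for all $\hat x,x\in\mathcal{X}$. 2. The sequence of functions $(\phi_i)_{i=0}^{N}$ is unique (i.e., for every $(\hat x,x)$ the minimizing sequence is unique), and its second element $\phi_1$ is continuous. Let the control input $u_k$ of the tracker satisfy $F(\hat x_k,u_k)=\phi_1(\hat x_k,x_k)$ for all $k\in\mathbb{N}$. Then for each $\varepsilon>0$ there exists $\delta>0$ such that, for all initial conditions $\hat x_0,x_0\in\mathcal{X}$, $\rho_{\rm x}(\hat x_0,x_0)\leq\delta$ implies $\rho_{\rm x}(\hat x_k,x_k)\leq\varepsilon$ for all $k\in\mathbb{N}$. Moreover, if the solutions $\hat x_k$ and $x_k$ belong to a bounded region $\mathcal{D}\subset\mathcal{X}$ for all $k\in\mathbb{N}$, then $\rho_{\rm x}(\hat x_k,x_k)\to 0$ as $k\to\infty$.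
   Context: $\mathbb{N}$ denotes the nonnegative integers and $\mathbb{R}_{\geq 0}$ the nonnegative reals. For a mapping $f:\mathcal{X}\to\mathcal{X}$, $f^{0}(x)=x$ and $f^{k+1}(x)=f(f^{k}(x))$. $F(\hat x,\mathcal{U})$ denotes the set $\{F(\hat x,u):u\in\mathcal{U}\}$. A function $\alpha:\mathbb{R}_{\geq 0}\to\mathbb{R}_{\geq 0}$ belongs to class $\mathcal{K}_\infty$ if it is continuous, zero at zero, strictly increasing, and unbounded. "Finite-dimensional complete metric space" is understood in the sense that every bounded sequence in the space has a convergent subsequence. Continuity of functions on $\mathcal{X}\times\mathcal{X}$ is with respect to the product topology. *)

theory Defs
  imports "HOL-Analysis.Analysis"
begin

text \<open>Comparison functions are total on the reals; only their values on \<open>{0..}\<close> are constrained.\<close>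

definition class_K_inf :: "(real \<Rightarrow> real) \<Rightarrow> bool" where
  "class_K_inf \<alpha> \<longleftrightarrow>
     (\<forall>r\<ge>0. \<alpha> r \<ge> 0) \<and> continuous_on {0..} \<alpha> \<and> \<alpha> 0 = 0 \<and>
     strict_mono_on {0..} \<alpha> \<and> \<not> bdd_above (\<alpha> ` {0..})"

text \<open>Finite sequences \<open>z\<^sub>0, \<dots>, z\<^sub>N\<close> are functions on \<open>nat\<close>. Neither the constraints nor the cost
  depend on the values at indices above \<open>N\<close>.\<close>

definition admissible ::
  "('a \<Rightarrow> 'a) \<Rightarrow> ('a \<Rightarrow> 'u \<Rightarrow> 'a) \<Rightarrow> 'u set \<Rightarrow> nat \<Rightarrow> 'a \<Rightarrow> 'a \<Rightarrow> (nat \<Rightarrow> 'a) \<Rightarrow> bool" where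
  "admissible f F U N xh x z \<longleftrightarrow>
     z 0 = xh \<and> (\<forall>i<N. z (Suc i) \<in> F (z i) ` U) \<and> z N = (f ^^ N) x"

definition cost :: "('a \<Rightarrow> 'a) \<Rightarrow> ('a \<Rightarrow> 'a \<Rightarrow> real) \<Rightarrow> nat \<Rightarrow> (nat \<Rightarrow> 'a) \<Rightarrow> real" where
  "cost f l N z = (\<Sum>i<N. l (z (Suc i)) (f (z i)))"

definition minimizer ::
  "('a \<Rightarrow> 'a) \<Rightarrow> ('a \<Rightarrow> 'u \<Rightarrow> 'a) \<Rightarrow> 'u set \<Rightarrow> ('a \<Rightarrow> 'a \<Rightarrow> real) \<Rightarrow> nat \<Rightarrow> 'a \<Rightarrow> 'a \<Rightarrow> (nat \<Rightarrow> 'a) \<Rightarrow> bool" where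
  "minimizer f F U l N xh x z \<longleftrightarrow> is_arg_min (cost f l N) (admissible f F U N xh x) z"

definition closed_loop ::
  "('a \<Rightarrow> 'a) \<Rightarrow> ('a \<Rightarrow> 'u \<Rightarrow> 'a) \<Rightarrow> 'u set \<Rightarrow> ('a \<Rightarrow> 'a \<Rightarrow> 'a) \<Rightarrow>
   (nat \<Rightarrow> 'a) \<Rightarrow> (nat \<Rightarrow> 'a) \<Rightarrow> (nat \<Rightarrow> 'u) \<Rightarrow> bool" where
  "closed_loop f F U \<kappa> xh x u \<longleftrightarrow>
     (\<forall>k. x (Suc k) = f (x k) \<and> xh (Suc k) = F (xh k) (u k) \<and>
          u k \<in> U \<and> F (xh k) (u k) = \<kappa> (xh k) (x k))"

end

theory Submission
  imports Defs
begin

text \<open>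
  The value function \<open>V\<close> is a Lyapunov function for the pair of system and tracker. If
  \<open>z\<^sub>0, \<dots>, z\<^sub>N\<close> is optimal at \<open>(xh, x)\<close>, then dropping \<open>z\<^sub>0\<close> and appending the exact image
  \<open>f z\<^sub>N\<close> yields a sequence that is admissible at the successor pair \<open>(z\<^sub>1, f x)\<close>. The appended
  stage is free, because \<open>l\<close> vanishes on the diagonal, and the dropped stage cost
  \<open>l z\<^sub>1 (f xh)\<close> (see \<open>minimizer_descent\<close>). Hence \<open>V\<close> does not increase along the closed loop,
  and sandwiching it between \<open>\<alpha>3\<close> and \<open>\<alpha>4\<close> gives stability.

  The decrease \<open>l z\<^sub>1 (f xh)\<close> can vanish away from the diagonal \<open>xh = x\<close>, so attraction needs an
  invariance argument in the style of LaSalle. On a bounded trajectory \<open>V\<close> converges to some \<open>c\<close>,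
  and through a cluster point of the trajectory passes another closed-loop trajectory on which
  \<open>V\<close> is constantly \<open>c\<close> (\<open>constant_along_limit_orbit\<close>); this is where continuity of \<open>V\<close>, \<open>f\<close>
  and \<open>\<phi> 1\<close> and compactness enter. Along that trajectory the descent is an equality, so the shifted
  optimal sequence is again optimal and, by uniqueness, is the one that the tracker computes next.
  The optimal sequence planned at the cluster point is therefore the sequence that the
  tracker actually follows, and each of its stages costs zero because \<open>V\<close> never drops. Thus
  \<open>c = 0\<close>.
\<close>

section \<open>Comparison functions\<close>

lemma class_K_inf_less_cancel:
  assumes "class_K_inf \<alpha>" "0 \<le> s" "\<alpha> r < \<alpha> s"
  shows "r < s"
proof (rule ccontr)
  assume "\<not> r < s"
  then have "\<alpha> s \<le> \<alpha> r"
    using assms strict_mono_on_leD[of "{0..}" \<alpha> s r] by (auto simp: class_K_inf_def)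
  then show False using assms by simp
qed

lemma class_K_inf_pos:
  assumes "class_K_inf \<alpha>" "0 < r"
  shows "0 < \<alpha> r"
  using assms strict_mono_onD[of "{0..}" \<alpha> 0 r] by (auto simp: class_K_inf_def)

lemma class_K_inf_small:
  assumes "class_K_inf \<alpha>" "0 < e"
  obtains d where "0 < d" "\<And>r. 0 \<le> r \<Longrightarrow> r \<le> d \<Longrightarrow> \<alpha> r < e"
proof -
  have "continuous_on {0..} \<alpha>" "\<alpha> 0 = 0" using assms(1) by (auto simp: class_K_inf_def)
  then obtain d where d: "d > 0" "\<And>r. r \<ge> 0 \<Longrightarrow> dist r 0 < d \<Longrightarrow> dist (\<alpha> r) 0 < e"
    using assms(2) unfolding continuous_on_iff by (metis atLeast_iff order_refl)
  show thesis
  proof (rule that[of "d/2"])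
    show "0 < d/2" using d by simp
    fix r :: real assume "0 \<le> r" "r \<le> d/2"
    then have "dist (\<alpha> r) 0 < e" using d by (intro d(2)) auto
    then show "\<alpha> r < e" by (simp add: dist_real_def)
  qed
qed

lemma class_K_inf_tendsto_zero:
  fixes r v :: "nat \<Rightarrow> real"
  assumes "class_K_inf \<alpha>" "\<And>k. 0 \<le> r k" "\<And>k. \<alpha> (r k) \<le> v k" "v \<longlonglongrightarrow> 0"
  shows "r \<longlonglongrightarrow> 0"
proof (rule order_tendstoI)
  fix e :: real assume "0 < e"
  then have "eventually (\<lambda>k. v k < \<alpha> e) sequentially"
    using assms(4) class_K_inf_pos[OF assms(1)] by (auto dest: order_tendstoD)
  then show "eventually (\<lambda>k. r k < e) sequentially"
    by (rule eventually_mono)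
      (use assms \<open>0 < e\<close> in \<open>meson class_K_inf_less_cancel le_less_trans less_imp_le\<close>)
next
  fix e :: real assume "e < 0"
  then show "eventually (\<lambda>k. e < r k) sequentially"
    using assms(2) by (intro always_eventually) (auto intro: less_le_trans)
qed

section \<open>Descent of the value function\<close>

definition shift :: "('a \<Rightarrow> 'a) \<Rightarrow> nat \<Rightarrow> (nat \<Rightarrow> 'a) \<Rightarrow> nat \<Rightarrow> 'a" where
  "shift f N z i = (if i < N then z (Suc i) else f (z N))"

text \<open>The terminal constraint is preserved because the appended step follows the system exactly:
  \<open>f (f\<^sup>N x) = f\<^sup>N (f x)\<close>.\<close>

lemma admissible_shift:
  assumes "\<And>y. f y \<in> F y ` U" "N \<ge> 1" "admissible f F U N xh x z"
  shows "admissible f F U N (z 1) (f x) (shift f N z)"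
proof -
  have "shift f N z (Suc i) \<in> F (shift f N z i) ` U" if "i < N" for i
  proof (cases "Suc i < N")
    case True
    then show ?thesis using assms(3) that by (auto simp: admissible_def shift_def)
  next
    case False
    then have "N = Suc i" using that by simp
    then show ?thesis using assms(1) by (simp add: shift_def)
  qed
  then show ?thesis
    using assms(2,3) by (simp add: admissible_def shift_def funpow_swap1)
qed

lemma cost_shift:
  assumes "\<And>y. l y y = 0" "N \<ge> 1"
  shows "cost f l N (shift f N z) = cost f l N z - l (z 1) (f (z 0))"
proof -
  obtain n where N: "N = Suc n" using assms(2) by (cases N) auto
  have "cost f l N z = l (z 1) (f (z 0)) + (\<Sum>i<n. l (z (Suc (Suc i))) (f (z (Suc i))))"
    unfolding cost_def N by (subst sum.lessThan_Suc_shift) simp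
  moreover have "cost f l N (shift f N z) = (\<Sum>i<n. l (z (Suc (Suc i))) (f (z (Suc i))))"
    unfolding cost_def N by (simp add: shift_def assms(1))
  ultimately show ?thesis by simp
qed

text \<open>The shifted sequence competes in the problem at the successor pair. Its cost gives
  the upper bound there, and if the bound is attained, it is itself optimal.\<close>

lemma minimizer_descent:
  assumes "\<And>y. f y \<in> F y ` U" "\<And>y. l y y = 0" "N \<ge> 1"
    and z: "minimizer f F U l N xh x z" and w: "minimizer f F U l N (z 1) (f x) w"
  shows "cost f l N w \<le> cost f l N z - l (z 1) (f xh)"
    and "cost f l N w = cost f l N z - l (z 1) (f xh) \<Longrightarrow>
         minimizer f F U l N (z 1) (f x) (shift f N z)"
proof -
  have adm: "admissible f F U N xh x z"
    using z by (simp add: minimizer_def is_arg_min_def)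
  then have cs: "cost f l N (shift f N z) = cost f l N z - l (z 1) (f xh)"
    using cost_shift[of l N f z] assms(2,3) by (simp add: admissible_def)
  have adms: "admissible f F U N (z 1) (f x) (shift f N z)"
    using admissible_shift[OF assms(1,3) adm] .
  show "cost f l N w \<le> cost f l N z - l (z 1) (f xh)"
    using w adms cs by (auto simp: minimizer_def is_arg_min_def not_less)
  show "minimizer f F U l N (z 1) (f x) (shift f N z)"
    if "cost f l N w = cost f l N z - l (z 1) (f xh)"
    using w adms cs that by (auto simp: minimizer_def is_arg_min_def)
qed

section \<open>Invariance\<close>

text \<open>This is the core of LaSalle's invariance principle. All shifts of the orbit converge along the
  same subsequence, to the points of the orbit of the cluster point \<open>q\<close>, while \<open>W\<close> has the
  same limit along each of them.\<close>

lemma constant_along_limit_orbit: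
  fixes g :: "'b::heine_borel \<Rightarrow> 'b" and W :: "'b \<Rightarrow> real"
  assumes g: "continuous_on UNIV g" and W: "continuous_on UNIV W"
    and nonneg: "\<And>p. 0 \<le> W p" and descent: "\<And>p. W (g p) \<le> W p"
    and bdd: "bounded (range (\<lambda>k. (g ^^ k) p))"
  obtains c q where "(\<lambda>k. W ((g ^^ k) p)) \<longlonglongrightarrow> c" "\<And>i. W ((g ^^ i) q) = c"
proof -
  have "decseq (\<lambda>k. W ((g ^^ k) p))" using descent by (intro decseq_SucI) simp
  then obtain c where c: "(\<lambda>k. W ((g ^^ k) p)) \<longlonglongrightarrow> c"
    using decseq_convergent[of "\<lambda>k. W ((g ^^ k) p)" 0] nonneg by blast
  obtain q r where r: "strict_mono r" and q: "((\<lambda>k. (g ^^ k) p) \<circ> r) \<longlonglongrightarrow> q"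
    using bounded_imp_convergent_subsequence[OF bdd] by blast
  have "W ((g ^^ i) q) = c" for i
  proof -
    have "(\<lambda>j. (g ^^ i) ((g ^^ r j) p)) \<longlonglongrightarrow> (g ^^ i) q"
    proof (induction i)
      case 0
      then show ?case using q by (simp add: o_def)
    next
      case (Suc i)
      then show ?case using continuous_on_tendsto_compose[OF g Suc] by simp
    qed
    from continuous_on_tendsto_compose[OF W this]
    have "(\<lambda>j. W ((g ^^ (i + r j)) p)) \<longlonglongrightarrow> W ((g ^^ i) q)"
      by (simp add: funpow_add)
    moreover have "filterlim (\<lambda>j. i + r j) sequentially sequentially"
      using r by (intro filterlim_subseq) (simp add: strict_mono_def)
    then have "(\<lambda>j. W ((g ^^ (i + r j)) p)) \<longlonglongrightarrow> c"
      by (rule filterlim_compose[OF c])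
    ultimately show ?thesis by (rule LIMSEQ_unique)
  qed
  then show thesis using c that by blast
qed

text \<open>If the value does not drop along a closed-loop trajectory, then the tracker never
  revises its plan: uniqueness identifies the planned sequence with the states that the tracker
  visits, and each of these was reached at zero stage cost. Hence the plan costs nothing.\<close>

lemma value_zero_if_constant:
  assumes feas: "\<And>y. f y \<in> F y ` U" and l0: "\<And>y. l y y = (0::real)" and "N \<ge> 1"
    and nonneg: "\<And>y y'. 0 \<le> l y y'"
    and min: "\<And>xh x. minimizer f F U l N xh x (\<lambda>i. \<phi> i xh x)"
    and uniq: "\<And>xh x z. minimizer f F U l N xh x z \<Longrightarrow> \<forall>i\<le>N. z i = \<phi> i xh x"
    and a: "\<And>k. a (Suc k) = \<phi> 1 (a k) (b k)" and b: "\<And>k. b (Suc k) = f (b k)"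
    and const: "\<And>k. cost f l N (\<lambda>i. \<phi> i (a k) (b k)) = c"
  shows "c = 0"
proof -
  have start: "\<phi> 0 xh x = xh" for xh x
    using min[of xh x] by (simp add: minimizer_def is_arg_min_def admissible_def)
  have succ: "minimizer f F U l N (\<phi> 1 (a k) (b k)) (f (b k))
      (\<lambda>i. \<phi> i (a (Suc k)) (b (Suc k)))" for k
    using min[of "a (Suc k)" "b (Suc k)"] unfolding a b by simp
  have stage: "l (a (Suc k)) (f (a k)) = 0" for k
    using minimizer_descent(1)[OF feas l0 \<open>N \<ge> 1\<close> min[of "a k" "b k"] succ[of k]]
      nonneg[of "a (Suc k)" "f (a k)"] const[of k] const[of "Suc k"] by (simp add: a)
  have opt: "minimizer f F U l N (a (Suc k)) (b (Suc k)) (shift f N (\<lambda>i. \<phi> i (a k) (b k)))" for k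
    using minimizer_descent(2)[OF feas l0 \<open>N \<ge> 1\<close> min[of "a k" "b k"] succ[of k]]
      stage[of k] const[of k] const[of "Suc k"] by (simp add: a b)
  have replan: "\<phi> j (a (Suc k)) (b (Suc k)) = \<phi> (Suc j) (a k) (b k)" if "j < N" for j k
    using that uniq[OF opt[of k], rule_format, of j] by (simp add: shift_def)
  have follow: "\<phi> j (a k) (b k) = a (k + j)" if "j \<le> N" for j k
    using that
  proof (induction j arbitrary: k)
    case 0
    then show ?case by (simp add: start)
  next
    case (Suc j)
    then show ?case using replan[of j k] Suc.IH[of "Suc k"] by simp
  qed
  have "cost f l N (\<lambda>i. \<phi> i (a 0) (b 0)) = (\<Sum>i<N. l (a (Suc i)) (f (a i)))"
    unfolding cost_def by (intro sum.cong) (simp_all add: follow)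
  then show ?thesis using const[of 0] stage by simp
qed

section \<open>Stability and attraction\<close>

theorem theorem5:
  fixes f :: "'a::heine_borel \<Rightarrow> 'a"
    and F :: "'a \<Rightarrow> 'u \<Rightarrow> 'a"
    and U :: "'u set"
    and l :: "'a \<Rightarrow> 'a \<Rightarrow> real"
    and \<alpha>1 \<alpha>2 :: "real \<Rightarrow> real"
    and N :: nat
    and V :: "'a \<Rightarrow> 'a \<Rightarrow> real"
    and \<phi> :: "nat \<Rightarrow> 'a \<Rightarrow> 'a \<Rightarrow> 'a"
  assumes "continuous_on UNIV f"
    and "\<And>xh. f xh \<in> F xh ` U"
    and "\<And>\<xi> \<zeta>. l \<xi> \<zeta> \<ge> 0"
    and "\<And>\<xi> \<zeta>. l \<xi> \<zeta> = l \<zeta> \<xi>"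
    and "class_K_inf \<alpha>1" and "class_K_inf \<alpha>2"
    and "\<And>\<xi> \<zeta>. \<alpha>1 (dist \<xi> \<zeta>) \<le> l \<xi> \<zeta> \<and> l \<xi> \<zeta> \<le> \<alpha>2 (dist \<xi> \<zeta>)"
    and "N \<ge> 1"
    and "\<And>xh x. minimizer f F U l N xh x (\<lambda>i. \<phi> i xh x)"
    and "\<And>xh x. V xh x = cost f l N (\<lambda>i. \<phi> i xh x)"
    and "continuous_on UNIV (\<lambda>(xh, x). V xh x)"
    and "\<exists>\<alpha>3 \<alpha>4. class_K_inf \<alpha>3 \<and> class_K_inf \<alpha>4 \<and>
           (\<forall>xh x. \<alpha>3 (dist xh x) \<le> V xh x \<and> V xh x \<le> \<alpha>4 (dist xh x))"
    and "\<And>xh x z. minimizer f F U l N xh x z \<Longrightarrow> \<forall>i\<le>N. z i = \<phi> i xh x"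
    and "continuous_on UNIV (\<lambda>(xh, x). \<phi> 1 xh x)"
  shows "(\<forall>\<epsilon>>0. \<exists>\<delta>>0. \<forall>xh x u. closed_loop f F U (\<phi> 1) xh x u \<longrightarrow>
             dist (xh 0) (x 0) \<le> \<delta> \<longrightarrow> (\<forall>k. dist (xh k) (x k) \<le> \<epsilon>)) \<and>
         (\<forall>xh x u D. closed_loop f F U (\<phi> 1) xh x u \<longrightarrow>
             bounded D \<longrightarrow> (\<forall>k. xh k \<in> D \<and> x k \<in> D) \<longrightarrow>
             (\<lambda>k. dist (xh k) (x k)) \<longlonglongrightarrow> 0)"
proof -
  note feas = assms(2) and nonneg = assms(3) and K2 = assms(6)
    and l_bounds = assms(7) and N = assms(8) and min = assms(9) and V = assms(10)
    and uniq = assms(13)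
  obtain \<alpha>3 \<alpha>4 where K3: "class_K_inf \<alpha>3" and K4: "class_K_inf \<alpha>4"
    and V_bounds: "\<And>xh x. \<alpha>3 (dist xh x) \<le> V xh x" "\<And>xh x. V xh x \<le> \<alpha>4 (dist xh x)"
    using assms(12) by blast
  have l0: "l y y = 0" for y
    using l_bounds[of y y] nonneg[of y y] K2 by (simp add: class_K_inf_def)
  have V_nonneg: "0 \<le> V xh x" for xh x
    unfolding V cost_def by (intro sum_nonneg nonneg)
  have V_descent: "V (\<phi> 1 xh x) (f x) \<le> V xh x" for xh x
  proof -
    have "V (\<phi> 1 xh x) (f x) \<le> V xh x - l (\<phi> 1 xh x) (f xh)"
      unfolding V by (rule minimizer_descent(1)[OF feas l0 N min min])
    then show ?thesis using nonneg[of "\<phi> 1 xh x" "f xh"] by simp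
  qed
  have step: "xh (Suc k) = \<phi> 1 (xh k) (x k)" "x (Suc k) = f (x k)"
    if "closed_loop f F U (\<phi> 1) xh x u" for xh x u k
    using that by (simp_all add: closed_loop_def)

  have stable: "\<exists>\<delta>>0. \<forall>xh x u. closed_loop f F U (\<phi> 1) xh x u \<longrightarrow>
             dist (xh 0) (x 0) \<le> \<delta> \<longrightarrow> (\<forall>k. dist (xh k) (x k) \<le> \<epsilon>)" if "\<epsilon> > 0" for \<epsilon> :: real
  proof -
    obtain \<delta> where \<delta>: "0 < \<delta>" "\<And>r. 0 \<le> r \<Longrightarrow> r \<le> \<delta> \<Longrightarrow> \<alpha>4 r < \<alpha>3 \<epsilon>"
      using class_K_inf_small[OF K4 class_K_inf_pos[OF K3 \<open>\<epsilon> > 0\<close>]] by blast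
    have "dist (xh k) (x k) \<le> \<epsilon>"
      if cl: "closed_loop f F U (\<phi> 1) xh x u" and "dist (xh 0) (x 0) \<le> \<delta>" for xh x u k
    proof -
      have "V (xh k) (x k) \<le> V (xh 0) (x 0)"
      proof (induction k)
        case (Suc k)
        then show ?case using V_descent[of "xh k" "x k"] by (simp only: step[OF cl])
      qed simp
      then have "\<alpha>3 (dist (xh k) (x k)) < \<alpha>3 \<epsilon>"
        using V_bounds(1)[of "xh k" "x k"] V_bounds(2)[of "xh 0" "x 0"]
          \<delta>(2)[of "dist (xh 0) (x 0)"] that by simp
      then show ?thesis
        using class_K_inf_less_cancel[OF K3] \<open>\<epsilon> > 0\<close> by (meson less_imp_le)
    qed
    then show ?thesis using \<delta>(1) by blast
  qed

  have attractive: "(\<lambda>k. dist (xh k) (x k)) \<longlonglongrightarrow> 0"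
    if cl: "closed_loop f F U (\<phi> 1) xh x u" and "bounded D" and D: "\<forall>k. xh k \<in> D \<and> x k \<in> D"
    for xh x u D
  proof -
    define g where "g = (\<lambda>(xh, x). (\<phi> 1 xh x, f x))"
    define W where "W = (\<lambda>(xh, x). V xh x)"
    have orbit: "(g ^^ k) (xh 0, x 0) = (xh k, x k)" for k
      by (induction k) (simp_all add: g_def step[OF cl])
    have "continuous_on UNIV (f \<circ> snd :: 'a \<times> 'a \<Rightarrow> 'a)"
      using assms(1) by (intro continuous_on_compose continuous_on_snd continuous_on_id)
        (auto intro: continuous_on_subset)
    then have "continuous_on UNIV g"
      using continuous_on_Pair[OF assms(14), of "f \<circ> snd"]
      by (simp add: g_def case_prod_unfold o_def)
    moreover have "continuous_on UNIV W"
      using assms(11) by (simp add: W_def)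
    moreover have "0 \<le> W p" "W (g p) \<le> W p" for p
      using V_nonneg V_descent by (simp_all add: W_def g_def case_prod_unfold)
    moreover have "bounded (range (\<lambda>k. (g ^^ k) (xh 0, x 0)))"
      by (rule bounded_subset[OF bounded_Times[OF \<open>bounded D\<close> \<open>bounded D\<close>]])
        (use D in \<open>auto simp: orbit\<close>)
    ultimately obtain c q where c: "(\<lambda>k. W ((g ^^ k) (xh 0, x 0))) \<longlonglongrightarrow> c"
      and const: "\<And>i. W ((g ^^ i) q) = c"
      using constant_along_limit_orbit[of g W "(xh 0, x 0)"] by blast
    have "c = 0"
    proof (rule value_zero_if_constant[where f=f and F=F and U=U and l=l and N=N and \<phi>=\<phi>,
          OF feas l0 N nonneg min uniq])
      fix k
      show "fst ((g ^^ Suc k) q) = \<phi> 1 (fst ((g ^^ k) q)) (snd ((g ^^ k) q))"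
        and "snd ((g ^^ Suc k) q) = f (snd ((g ^^ k) q))"
        by (simp_all add: g_def case_prod_unfold)
      show "cost f l N (\<lambda>i. \<phi> i (fst ((g ^^ k) q)) (snd ((g ^^ k) q))) = c"
        using const[of k] by (simp add: W_def case_prod_unfold V)
    qed
    then have "(\<lambda>k. V (xh k) (x k)) \<longlonglongrightarrow> 0"
      using c by (simp add: orbit W_def)
    then show ?thesis
      by (intro class_K_inf_tendsto_zero[OF K3 _ V_bounds(1)]) auto
  qed

  show ?thesis using stable attractive by blast
qed

end
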